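(* Let $s\ge 2$ and let $f_1(x),\ldots,f_s(x)\in\mathbb{Z}[x]$ be nonzero coprime polynomials. For $n\in\mathbb{Z}$ let $d_n=\gcd(f_1(n),\ldots,f_s(n))$ and let $\mathcal{D}^\ast=\{d_n \mid n\in\mathbb{Z}\}$. Then the sequence $(d_n)_{n\in\mathbb{Z}}$ is periodic, the set $\mathcal{D}^\ast$ is finite, and $\mathcal{D}^\ast$ is stable under gcd and under lcm (i.e. for all $n_1,n_2\in\mathbb{Z}$ there exist $n,n'\in\mathbb{Z}$ with $\gcd(d_{n_1},d_{n_2})=d_n$ and $\operatorname{lcm}(d_{n_1},d_{n_2})=d_{n'}$). Consequently, the gcd $d^\ast$ and the lcm $m^\ast$ of all the integers $d_n$ ($n\in\mathbb{Z}$) belong to $\mathcal{D}^\ast$.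
   Context: Polynomials $f_1,\ldots,f_s\in\mathbb{Z}[x]$ are called coprime if their gcd in $\mathbb{Q}[x]$ is $1$, equivalently they have no common complex root. The gcd of integers is taken to be nonnegative. *)

theory Defs
  imports
    "HOL-Computational_Algebra.Computational_Algebra"
    "HOL-Computational_Algebra.Field_as_Ring"
begin

text \<open>
  The gcd on \<^typ>\<open>rat poly\<close> is normalized to be monic (or zero), so coprimality over the rationals
  is literally that the gcd equals \<^term>\<open>1\<close>.
\<close>
definition coprime_polys :: "nat \<Rightarrow> (nat \<Rightarrow> int poly) \<Rightarrow> bool" where
  "coprime_polys s f \<longleftrightarrow> (GCD i\<in>{1..s}. map_poly rat_of_int (f i)) = 1"

definition gcd_value :: "nat \<Rightarrow> (nat \<Rightarrow> int poly) \<Rightarrow> int \<Rightarrow> int" where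
  "gcd_value s f n = (GCD i\<in>{1..s}. poly (f i) n)"

definition gcd_values :: "nat \<Rightarrow> (nat \<Rightarrow> int poly) \<Rightarrow> int set" where
  "gcd_values s f = range (gcd_value s f)"

definition periodic_seq :: "(int \<Rightarrow> 'a) \<Rightarrow> bool" where
  "periodic_seq d \<longleftrightarrow> (\<exists>T>0. \<forall>n. d (n + T) = d n)"

end

theory Submission
  imports Defs "HOL-Number_Theory.Cong"
begin

text \<open>
  A Bezout relation over the rationals, evaluated at integers and cleared of denominators, gives
  \<open>\<delta> > 0\<close> divisible by every \<open>d\<^sub>n\<close>. For a prime \<open>p\<close>, the \<open>p\<close>-adic valuation of \<open>d\<^sub>n\<close> is thus
  determined by \<open>n\<close> modulo \<open>p\<^sup>e\<close>, where \<open>e\<close> is the valuation of \<open>\<delta>\<close>. By the Chinese remainder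
  theorem the valuations of \<open>d\<^sub>n\<close> at different primes can be prescribed independently among those
  which occur, in particular as the minima or the maxima of the valuations of \<open>d\<^sub>n\<^sub>1\<close> and \<open>d\<^sub>n\<^sub>2\<close>.
\<close>

section \<open>Bezout relations and a positive common multiple of all values\<close>

lemma Gcd_image_eq_sum:
  fixes g :: "'b \<Rightarrow> 'a :: {euclidean_ring_gcd, semiring_Gcd}"
  assumes "finite A"
  shows "\<exists>u. Gcd (g ` A) = (\<Sum>i\<in>A. u i * g i)"
  using assms
proof (induction A rule: finite_induct)
  case (insert x A)
  then obtain u where u: "Gcd (g ` A) = (\<Sum>i\<in>A. u i * g i)"
    by blast
  obtain a b where ab: "a * g x + b * Gcd (g ` A) = gcd (g x) (Gcd (g ` A))"
    using bezout_coefficients_fst_snd by blast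
  \<comment> \<open>Since \<open>x\<close> is not in \<open>A\<close>, the new coefficient
    \<open>a\<close> at \<open>x\<close> does not disturb the rescaled relation over
    \<open>A\<close>.\<close>
  define v where "v = (\<lambda>i. if i = x then a else b * u i)"
  have "(\<Sum>i\<in>A. v i * g i) = (\<Sum>i\<in>A. b * (u i * g i))"
    using insert.hyps by (intro sum.cong) (auto simp: v_def mult.assoc)
  then have "(\<Sum>i\<in>insert x A. v i * g i) = a * g x + b * Gcd (g ` A)"
    using insert.hyps by (simp add: v_def u sum_distrib_left)
  with ab show ?case
    by (metis Gcd_insert image_insert)
qed simp

text \<open>By Horner's rule, \<open>D\<close> can be built as the product of the denominators of
  the coefficients, which makes it uniform in \<open>n\<close>.\<close>

lemma rat_poly_common_denominator:
  fixes q :: "rat poly"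
  shows "\<exists>D>0. \<forall>n. of_int D * poly q (of_int n) \<in> \<int>"
proof (induction q)
  case (pCons a q)
  then obtain D where D: "D > 0" "\<And>n. of_int D * poly q (of_int n) \<in> \<int>"
    by blast
  obtain b c where bc: "quotient_of a = (b, c)"
    by fastforce
  then have c: "c > 0" "a = of_int b / of_int c"
    using quotient_of_denom_pos quotient_of_div by blast+
  have "of_int (c * D) * poly (pCons a q) (of_int n) \<in> \<int>" for n
  proof -
    have "of_int (c * D) * poly (pCons a q) (of_int n)
        = of_int (D * b) + of_int (c * n) * (of_int D * poly q (of_int n))"
      using c by (simp add: field_simps)
    also have "\<dots> \<in> \<int>"
      using D(2) by (rule Ints_add[OF Ints_of_int Ints_mult[OF Ints_of_int]])
    finally show ?thesis .
  qed
  with D(1) c(1) show ?case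
    by (metis mult_pos_pos)
qed (auto intro: exI[of _ 1])

lemma poly_map_poly_of_int:
  "poly (map_poly of_int p) (of_int n) = (of_int (poly p n) :: 'a :: {comm_ring_1, ring_char_0})"
  by (induction p) (simp_all add: map_poly_pCons)

lemma gcd_value_dvd_constant:
  assumes "coprime_polys s f"
  obtains \<delta> where "\<delta> > 0" "\<And>n. gcd_value s f n dvd \<delta>"
proof -
  obtain u where u: "(\<Sum>i\<in>{1..s}. u i * map_poly rat_of_int (f i)) = 1"
    using Gcd_image_eq_sum[of "{1..s}" "\<lambda>i. map_poly rat_of_int (f i)"] assms
    unfolding coprime_polys_def by force
  obtain D where D: "\<And>i. D i > 0" "\<And>i n. of_int (D i) * poly (u i) (of_int n) \<in> \<int>"
    using rat_poly_common_denominator[of "u _"] by metis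
  \<comment> \<open>The product clears the denominators of all Bezout cofactors at once and is
    independent of \<open>n\<close>.\<close>
  define \<delta> where "\<delta> = (\<Prod>i\<in>{1..s}. D i)"
  have "gcd_value s f n dvd \<delta>" for n
  proof -
    have "\<exists>z. of_int \<delta> * poly (u i) (of_int n) = rat_of_int z" if i: "i \<in> {1..s}" for i
    proof -
      have "\<delta> = (\<Prod>j\<in>{1..s} - {i}. D j) * D i"
        using i by (simp add: \<delta>_def prod.remove mult.commute)
      then have "of_int \<delta> * poly (u i) (of_int n)
          = of_int (\<Prod>j\<in>{1..s} - {i}. D j) * (of_int (D i) * poly (u i) (of_int n))"
        by simp
      also have "\<dots> \<in> \<int>"
        using D(2) by (rule Ints_mult[OF Ints_of_int])
      finally show ?thesis
        by (auto elim: Ints_cases)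
    qed
    then obtain z where z: "\<And>i. i \<in> {1..s} \<Longrightarrow>
        of_int \<delta> * poly (u i) (of_int n) = rat_of_int (z i)"
      by metis
    have "1 = poly (\<Sum>i\<in>{1..s}. u i * map_poly rat_of_int (f i)) (of_int n)"
      by (simp only: u poly_1)
    also have "\<dots> = (\<Sum>i\<in>{1..s}. poly (u i) (of_int n) * of_int (poly (f i) n))"
      by (simp add: poly_sum poly_map_poly_of_int)
    finally have "rat_of_int \<delta>
        = of_int \<delta> * (\<Sum>i\<in>{1..s}. poly (u i) (of_int n) * of_int (poly (f i) n))"
      by simp
    also have "\<dots> = (\<Sum>i\<in>{1..s}. of_int (z i) * of_int (poly (f i) n))"
      unfolding sum_distrib_left by (intro sum.cong) (simp_all add: z flip: mult.assoc)
    also have "\<dots> = of_int (\<Sum>i\<in>{1..s}. z i * poly (f i) n)"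
      by simp
    finally have "\<delta> = (\<Sum>i\<in>{1..s}. z i * poly (f i) n)"
      by (simp only: of_int_eq_iff)
    also have "gcd_value s f n dvd \<dots>"
      unfolding gcd_value_def by (intro dvd_sum dvd_mult Gcd_dvd) auto
    finally show ?thesis .
  qed
  moreover have "\<delta> > 0"
    unfolding \<delta>_def using D(1) by (intro prod_pos) auto
  ultimately show thesis
    using that by blast
qed

lemma gcd_value_nonneg: "gcd_value s f n \<ge> 0"
  by (simp add: gcd_value_def)

text \<open>A divisor of a positive integer is not \<open>0\<close>. This keeps valuations
  meaningful, as \<open>multiplicity p 0\<close> is \<open>0\<close> by default.\<close>

lemma gcd_value_nonzero:
  assumes "coprime_polys s f"
  shows "gcd_value s f n \<noteq> 0"
  using gcd_value_dvd_constant[OF assms] by (metis dvd_0_left_iff less_irrefl)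

section \<open>Congruences and prime valuations of the values\<close>

lemma dvd_poly_diff_int:
  fixes p :: "int poly"
  shows "x - y dvd poly p x - poly p y"
proof (induction p)
  case (pCons a p)
  have "poly (pCons a p) x - poly (pCons a p) y
      = x * (poly p x - poly p y) + (x - y) * poly p y"
    by (simp add: algebra_simps)
  with pCons.IH show ?case
    by simp
qed simp

text \<open>Integer polynomials preserve congruences modulo \<open>k\<close>, so \<open>k\<close>
  divides each \<open>f i\<close> at both arguments or at neither.\<close>

lemma dvd_gcd_value_cong:
  assumes "k dvd n - m"
  shows "k dvd gcd_value s f n \<longleftrightarrow> k dvd gcd_value s f m"
proof -
  have "k dvd poly (f i) n \<longleftrightarrow> k dvd poly (f i) m" for i
    using dvd_trans[OF assms dvd_poly_diff_int, of "f i"]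
    by (metis dvd_diff_commute dvd_diff_right_iff dvd_diff_left_iff)
  then show ?thesis
    by (simp add: gcd_value_def dvd_Gcd_iff)
qed

text \<open>Powers of distinct primes are coprime, so the congruences can be merged one prime at a
  time.\<close>

lemma chinese_remainder_prime_powers_int:
  fixes P :: "int set" and c :: "int \<Rightarrow> int"
  assumes "finite P" "\<And>p. p \<in> P \<Longrightarrow> prime p"
  shows "\<exists>n. \<forall>p\<in>P. p ^ e p dvd n - c p"
  using assms
proof (induction P rule: finite_induct)
  case (insert q P)
  then obtain m where m: "\<forall>p\<in>P. p ^ e p dvd m - c p"
    by auto
  have "coprime (\<Prod>p\<in>P. p ^ e p) (q ^ e q)"
  proof (intro prod_coprime_left)
    fix p assume "p \<in> P"
    with insert show "coprime (p ^ e p) (q ^ e q)"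
      by (auto intro!: primes_coprime)
  qed
  then obtain n where n: "[n = m] (mod (\<Prod>p\<in>P. p ^ e p))" "[n = c q] (mod q ^ e q)"
    using binary_chinese_remainder_int by blast
  have "p ^ e p dvd n - c p" if "p \<in> P" for p
  proof -
    have "p ^ e p dvd (\<Prod>p\<in>P. p ^ e p)"
      using insert.hyps that by (intro dvd_prodI)
    then have "p ^ e p dvd n - m"
      using n(1) by (auto simp: cong_iff_dvd_diff intro: dvd_trans)
    with m that have "p ^ e p dvd (n - m) + (m - c p)"
      by (intro dvd_add) auto
    then show ?thesis
      by simp
  qed
  with n(2) show ?case
    by (auto simp: cong_iff_dvd_diff)
qed simp

text \<open>The function \<open>c\<close> selects, separately for each prime, the argument whose
  valuation is to be copied. Agreement modulo the full power of \<open>p\<close> in \<delta>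
  suffices, because no value has a larger valuation at \<open>p\<close> than \<delta>.\<close>

lemma gcd_value_prescribed_multiplicities:
  assumes "coprime_polys s f"
  shows "\<exists>n. \<forall>p. prime p \<longrightarrow>
    multiplicity p (gcd_value s f n) = multiplicity p (gcd_value s f (c p))"
proof -
  obtain \<delta> where \<delta>: "\<delta> > 0" "\<And>n. gcd_value s f n dvd \<delta>"
    using gcd_value_dvd_constant[OF assms] by blast
  obtain n where n: "\<forall>p\<in>prime_factors \<delta>. p ^ multiplicity p \<delta> dvd n - c p"
    using chinese_remainder_prime_powers_int[of "prime_factors \<delta>"]
    by (meson finite_set_mset in_prime_factors_imp_prime)
  have "multiplicity p (gcd_value s f n) = multiplicity p (gcd_value s f (c p))"
    if p: "prime p" for p
  proof -
    \<comment> \<open>For \<open>p\<close> not dividing \<delta> the exponent is \<open>0\<close>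
      and the divisor is \<open>1\<close>.\<close>
    have "p ^ multiplicity p \<delta> dvd n - c p"
      using n p \<delta>(1) by (cases "p dvd \<delta>") (auto simp: prime_factors_dvd not_dvd_imp_multiplicity_0)
    then have eq: "p ^ k dvd gcd_value s f n \<longleftrightarrow> p ^ k dvd gcd_value s f (c p)"
      if "k \<le> multiplicity p \<delta>" for k
      using that by (intro dvd_gcd_value_cong) (meson dvd_trans le_imp_power_dvd)
    have le: "multiplicity p (gcd_value s f m) \<le> multiplicity p \<delta>" for m
      using \<delta> by (intro dvd_imp_multiplicity_le) auto
    have "\<not> is_unit p"
      using p by auto
    \<comment> \<open>By \<open>le\<close>, the exact power of \<open>p\<close> in either value lies
      in the range of \<open>eq\<close>, hence divides the other value too.\<close>
    show ?thesis
    proof (rule antisym)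
      show "multiplicity p (gcd_value s f n) \<le> multiplicity p (gcd_value s f (c p))"
        using eq[OF le, of n] \<open>\<not> is_unit p\<close> gcd_value_nonzero[OF assms]
        by (intro multiplicity_geI) (auto simp: multiplicity_dvd)
      show "multiplicity p (gcd_value s f (c p)) \<le> multiplicity p (gcd_value s f n)"
        using eq[OF le, of "c p"] \<open>\<not> is_unit p\<close> gcd_value_nonzero[OF assms]
        by (intro multiplicity_geI) (auto simp: multiplicity_dvd)
    qed
  qed
  then show ?thesis
    by blast
qed

section \<open>Closure under gcd and lcm\<close>

lemma eq_if_multiplicity_eq_int:
  fixes x y :: int
  assumes "x > 0" "y > 0" "\<And>p. prime p \<Longrightarrow> multiplicity p x = multiplicity p y"
  shows "x = y"
  using multiplicity_eq_imp_eq[of x y] assms by auto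

lemma gcd_value_gcd_closed:
  assumes "coprime_polys s f"
  shows "\<exists>n. gcd (gcd_value s f n1) (gcd_value s f n2) = gcd_value s f n"
proof -
  let ?d = "gcd_value s f"
  \<comment> \<open>The valuation of a gcd is the minimum, so each prime selects the argument with
    the smaller valuation.\<close>
  obtain n where n: "\<And>p. prime p \<Longrightarrow> multiplicity p (?d n)
      = multiplicity p (?d (if multiplicity p (?d n1) \<le> multiplicity p (?d n2) then n1 else n2))"
    using gcd_value_prescribed_multiplicities[OF assms,
      of "\<lambda>p. if multiplicity p (?d n1) \<le> multiplicity p (?d n2) then n1 else n2"] by blast
  have "gcd (?d n1) (?d n2) = ?d n"
  proof (rule eq_if_multiplicity_eq_int)
    fix p :: int assume "prime p"
    then show "multiplicity p (gcd (?d n1) (?d n2)) = multiplicity p (?d n)"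
      using gcd_value_nonzero[OF assms] by (simp add: multiplicity_gcd n)
  qed (use gcd_value_nonzero[OF assms] gcd_value_nonneg in \<open>auto simp: less_le\<close>)
  then show ?thesis ..
qed

lemma gcd_value_lcm_closed:
  assumes "coprime_polys s f"
  shows "\<exists>n. lcm (gcd_value s f n1) (gcd_value s f n2) = gcd_value s f n"
proof -
  let ?d = "gcd_value s f"
  \<comment> \<open>The branches are swapped to select the maximum, the valuation of an lcm.\<close>
  obtain n where n: "\<And>p. prime p \<Longrightarrow> multiplicity p (?d n)
      = multiplicity p (?d (if multiplicity p (?d n1) \<le> multiplicity p (?d n2) then n2 else n1))"
    using gcd_value_prescribed_multiplicities[OF assms,
      of "\<lambda>p. if multiplicity p (?d n1) \<le> multiplicity p (?d n2) then n2 else n1"] by blast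
  have "lcm (?d n1) (?d n2) = ?d n"
  proof (rule eq_if_multiplicity_eq_int)
    fix p :: int assume "prime p"
    then show "multiplicity p (lcm (?d n1) (?d n2)) = multiplicity p (?d n)"
      using gcd_value_nonzero[OF assms] by (simp add: multiplicity_lcm n)
  qed (use gcd_value_nonzero[OF assms] gcd_value_nonneg in \<open>auto simp: less_le lcm_pos_int\<close>)
  then show ?thesis ..
qed

text \<open>The binary operation is folded over \<open>A\<close>, while the closed set
  \<open>B\<close> stays fixed during the induction. Normalization handles singletons, where
  \<open>Gcd {x}\<close> is \<open>normalize x\<close>.\<close>

lemma Gcd_mem_if_gcd_closed:
  fixes A :: "'a :: semiring_Gcd set"
  assumes "finite A" "A \<noteq> {}" "A \<subseteq> B"
    and "\<And>x. x \<in> B \<Longrightarrow> normalize x = x" "\<And>x y. x \<in> B \<Longrightarrow> y \<in> B \<Longrightarrow> gcd x y \<in> B"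
  shows "Gcd A \<in> B"
  using assms by (induction A rule: finite_ne_induct) auto

lemma Lcm_mem_if_lcm_closed:
  fixes A :: "'a :: semiring_Gcd set"
  assumes "finite A" "A \<noteq> {}" "A \<subseteq> B"
    and "\<And>x. x \<in> B \<Longrightarrow> normalize x = x" "\<And>x y. x \<in> B \<Longrightarrow> y \<in> B \<Longrightarrow> lcm x y \<in> B"
  shows "Lcm A \<in> B"
  using assms by (induction A rule: finite_ne_induct) auto

theorem theorem1p2:
  fixes s :: nat and f :: "nat \<Rightarrow> int poly"
  assumes "s \<ge> 2"
    and "\<And>i. i \<in> {1..s} \<Longrightarrow> f i \<noteq> 0"
    and "coprime_polys s f"
  shows "periodic_seq (gcd_value s f)
    \<and> finite (gcd_values s f)
    \<and> (\<forall>n1 n2. \<exists>n. gcd (gcd_value s f n1) (gcd_value s f n2) = gcd_value s f n)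
    \<and> (\<forall>n1 n2. \<exists>n'. lcm (gcd_value s f n1) (gcd_value s f n2) = gcd_value s f n')
    \<and> (GCD n. gcd_value s f n) \<in> gcd_values s f
    \<and> (LCM n. gcd_value s f n) \<in> gcd_values s f"
proof -
  obtain \<delta> where \<delta>: "\<delta> > 0" "\<And>n. gcd_value s f n dvd \<delta>"
    using gcd_value_dvd_constant[OF assms(3)] by blast
  \<comment> \<open>The period is \<delta> itself: each of the two values divides the shift
    \<delta>, so taking it as the modulus \<open>k\<close> shows that it divides the other.\<close>
  have "gcd_value s f (n + \<delta>) = gcd_value s f n" for n
  proof (rule zdvd_antisym_nonneg)
    show "gcd_value s f (n + \<delta>) dvd gcd_value s f n"
      using dvd_gcd_value_cong[of "gcd_value s f (n + \<delta>)" "n + \<delta>" n s f] \<delta>(2) by simp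
    show "gcd_value s f n dvd gcd_value s f (n + \<delta>)"
      using dvd_gcd_value_cong[of "gcd_value s f n" "n + \<delta>" n s f] \<delta>(2) by simp
  qed (simp_all add: gcd_value_nonneg)
  with \<delta>(1) have periodic: "periodic_seq (gcd_value s f)"
    unfolding periodic_seq_def by blast
  have "gcd_values s f \<subseteq> {0..\<delta>}"
    using zdvd_imp_le[OF \<delta>(2,1)] by (auto simp: gcd_values_def gcd_value_nonneg)
  then have finite: "finite (gcd_values s f)"
    by (rule finite_subset) simp
  have norm: "normalize x = x" if "x \<in> gcd_values s f" for x
    using that by (auto simp: gcd_values_def gcd_value_nonneg)
  have gcd: "gcd x y \<in> gcd_values s f" and lcm: "lcm x y \<in> gcd_values s f"
    if "x \<in> gcd_values s f" "y \<in> gcd_values s f" for x y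
  proof -
    from that obtain n1 n2 where xy: "x = gcd_value s f n1" "y = gcd_value s f n2"
      by (auto simp: gcd_values_def)
    show "gcd x y \<in> gcd_values s f" "lcm x y \<in> gcd_values s f"
      using gcd_value_gcd_closed[OF assms(3), of n1 n2] gcd_value_lcm_closed[OF assms(3), of n1 n2]
      by (auto simp: xy gcd_values_def)
  qed
  have "gcd_values s f \<noteq> {}"
    by (simp add: gcd_values_def)
  \<comment> \<open>Finiteness reduces the gcd and lcm of all values to the binary closures, with
    \<open>gcd_values s f\<close> as both \<open>A\<close> and \<open>B\<close>.\<close>
  then have "Gcd (gcd_values s f) \<in> gcd_values s f" "Lcm (gcd_values s f) \<in> gcd_values s f"
    using Gcd_mem_if_gcd_closed[OF finite _ order_refl norm gcd]
      Lcm_mem_if_lcm_closed[OF finite _ order_refl norm lcm] by blast+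
  then show ?thesis
    using periodic finite gcd_value_gcd_closed[OF assms(3)] gcd_value_lcm_closed[OF assms(3)]
    by (auto simp: gcd_values_def)
qed

end
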